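(* With respect to the basis of $1$-vectors for $Cl(0,5)=M(4,\mathbb{C})$ given by $$g_1=\sigma_x\otimes(iI_2),\quad g_2=(i\sigma_y)\otimes\sigma_y,\quad g_3=(i\sigma_y)\otimes\sigma_z,\quad g_4=(i\sigma_z)\otimes I_2,\quad g_5=(i\sigma_y)\otimes\sigma_x,$$ reversion on $Cl(0,5)=M(4,\mathbb{C})$ is given by $\Phi^{rev}(X)=\widetilde{J}_4^{-1}X^T\widetilde{J}_4$.
   Context: Pauli matrices: $\sigma_x=\begin{pmatrix}0&1\\1&0\end{pmatrix}$, $\sigma_y=\begin{pmatrix}0&-i\\i&0\end{pmatrix}$, $\sigma_z=\begin{pmatrix}1&0\\0&-1\end{pmatrix}$; $\otimes$ is the Kronecker product. $J_2=\begin{pmatrix}0&1\\-1&0\end{pmatrix}$, $\widetilde{J}_4=J_2\oplus J_2$. $Cl(p,q)$ is the real Clifford algebra generated by $p+q$ pairwise anticommuting generators, $p$ of which square to $+1$ and $q$ to $-1$. To say that a set of matrices in a matrix algebra $\mathcal{A}$ (viewed as a real algebra) is a basis of $1$-vectors for $Cl(p,q)=\mathcal{A}$ means that they satisfy these relations and that $\mathcal{A}$ is thereby identified with $Cl(p,q)$; the space of $1$-vectors is their real span. Reversion is the unique real-linear anti-automorphism fixing $1$ and every $1$-vector. *)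

theory Defs
  imports "HOL-Analysis.Analysis" "HOL-Library.Poly_Mapping"
begin

section \<open>Clifford algebras by generators and relations\<close>

text \<open>
  The free unital associative real algebra on \<open>n\<close> generators consists of the finitely supported
  real functions on words over \<open>{..<n}\<close>; the word \<open>w\<close> stands for the noncommutative monomial
  \<open>Poly_Mapping.single w 1\<close>.
\<close>

definition free_alg :: "nat \<Rightarrow> (nat list \<Rightarrow>\<^sub>0 real) set" where
  "free_alg n = {f. \<forall>w \<in> Poly_Mapping.keys f. set w \<subseteq> {..<n}}"

definition clifford_sign :: "nat \<Rightarrow> nat \<Rightarrow> real" where
  "clifford_sign p i = (if i < p then 1 else - 1)"

text \<open>
  The two-sided ideal generated by \<open>e\<^sub>i e\<^sub>j + e\<^sub>j e\<^sub>i\<close> (\<open>i \<noteq> j\<close>) and \<open>e\<^sub>i e\<^sub>i - clifford_sign p i\<close>: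
  as words span the free algebra, it is the set of finite sums of elements \<open>c u r v\<close> with \<open>c\<close> real,
  \<open>u\<close> and \<open>v\<close> words and \<open>r\<close> one of these generators. \<open>Cl(p,q)\<close> is the quotient of
  \<open>free_alg (p + q)\<close> by this ideal.
\<close>

inductive_set clifford_ideal :: "nat \<Rightarrow> nat \<Rightarrow> (nat list \<Rightarrow>\<^sub>0 real) set" for p q :: nat where
  zero: "0 \<in> clifford_ideal p q"
| add: "x \<in> clifford_ideal p q \<Longrightarrow> y \<in> clifford_ideal p q \<Longrightarrow> x + y \<in> clifford_ideal p q"
| anticommute: "i < p + q \<Longrightarrow> j < p + q \<Longrightarrow> i \<noteq> j \<Longrightarrow> set u \<subseteq> {..<p + q} \<Longrightarrow> set v \<subseteq> {..<p + q} \<Longrightarrow>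
    Poly_Mapping.single (u @ [i, j] @ v) c + Poly_Mapping.single (u @ [j, i] @ v) c
      \<in> clifford_ideal p q"
| square: "i < p + q \<Longrightarrow> set u \<subseteq> {..<p + q} \<Longrightarrow> set v \<subseteq> {..<p + q} \<Longrightarrow>
    Poly_Mapping.single (u @ [i, i] @ v) c - Poly_Mapping.single (u @ v) (c * clifford_sign p i)
      \<in> clifford_ideal p q"

text \<open>
  Evaluation of the free algebra in a full complex matrix algebra, sending the \<open>i\<close>th generator to
  \<open>gs ! i\<close>. The matrix product is \<open>**\<close>, the componentwise \<open>*\<close> of the vector type plays no role.
\<close>

definition eval_word :: "(complex^'n^'n) list \<Rightarrow> nat list \<Rightarrow> complex^'n^'n" where
  "eval_word gs w = foldr (\<lambda>i X. (gs ! i) ** X) w (mat 1)"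

definition eval_free :: "(complex^'n^'n) list \<Rightarrow> (nat list \<Rightarrow>\<^sub>0 real) \<Rightarrow> complex^'n^'n" where
  "eval_free gs f = (\<Sum>w \<in> Poly_Mapping.keys f. Poly_Mapping.lookup f w *\<^sub>R eval_word gs w)"

definition clifford_relations :: "nat \<Rightarrow> nat \<Rightarrow> (complex^'n^'n) list \<Rightarrow> bool" where
  "clifford_relations p q gs \<longleftrightarrow>
     length gs = p + q \<and>
     (\<forall>i < p + q. gs ! i ** gs ! i = clifford_sign p i *\<^sub>R mat 1) \<and>
     (\<forall>i < p + q. \<forall>j < p + q. i \<noteq> j \<longrightarrow> gs ! i ** gs ! j = - (gs ! j ** gs ! i))"

text \<open>
  \<open>gs\<close> is a basis of 1-vectors for \<open>Cl(p,q) = M(n,\<complex>)\<close>, the latter viewed as a real algebra: the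
  relations hold, and the algebra homomorphism from the quotient \<open>Cl(p,q)\<close> to \<open>M(n,\<complex>)\<close> that
  \<open>gs\<close> induces is surjective (second conjunct) and injective (third conjunct).
\<close>

definition one_vector_basis :: "nat \<Rightarrow> nat \<Rightarrow> (complex^'n^'n) list \<Rightarrow> bool" where
  "one_vector_basis p q gs \<longleftrightarrow>
     clifford_relations p q gs \<and>
     eval_free gs ` free_alg (p + q) = UNIV \<and>
     {f \<in> free_alg (p + q). eval_free gs f = 0} = clifford_ideal p q"

section \<open>Reversion\<close>

text \<open>\<^const>\<open>linear\<close> and \<^const>\<open>span\<close> are over the reals.\<close>

definition is_reversion :: "(complex^'n^'n) list \<Rightarrow> (complex^'n^'n \<Rightarrow> complex^'n^'n) \<Rightarrow> bool" where
  "is_reversion gs \<Phi> \<longleftrightarrow>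
     linear \<Phi> \<and> bij \<Phi> \<and> (\<forall>X Y. \<Phi> (X ** Y) = \<Phi> Y ** \<Phi> X) \<and>
     \<Phi> (mat 1) = mat 1 \<and> (\<forall>v \<in> span (set gs). \<Phi> v = v)"

definition reversion :: "(complex^'n^'n) list \<Rightarrow> complex^'n^'n \<Rightarrow> complex^'n^'n" where
  "reversion gs = (THE \<Phi>. is_reversion gs \<Phi>)"

section \<open>Concrete matrices\<close>

definition sigma_x :: "complex^2^2" where
  "sigma_x = vector [vector [0, 1], vector [1, 0]]"

definition sigma_y :: "complex^2^2" where
  "sigma_y = vector [vector [0, - \<i>], vector [\<i>, 0]]"

definition sigma_z :: "complex^2^2" where
  "sigma_z = vector [vector [1, 0], vector [0, - 1]]"

definition J2 :: "complex^2^2" where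
  "J2 = vector [vector [0, 1], vector [- 1, 0]]"

definition cmul :: "complex \<Rightarrow> complex^'n^'m \<Rightarrow> complex^'n^'m" where
  "cmul c A = (\<chi> r s. c * A $ r $ s)"

text \<open>
  An index of a \<open>4 \<times> 4\<close> matrix is split into a block index and an index within the block:
  \<open>1, 2, 3, 4\<close> correspond to \<open>(1,1), (1,2), (2,1), (2,2)\<close>.
\<close>

definition block :: "4 \<Rightarrow> 2" where
  "block r = (if r = 1 \<or> r = 2 then 1 else 2)"

definition entry :: "4 \<Rightarrow> 2" where
  "entry r = (if r = 1 \<or> r = 3 then 1 else 2)"

definition kron :: "complex^2^2 \<Rightarrow> complex^2^2 \<Rightarrow> complex^4^4"  (infixr "\<otimes>\<^sub>K" 75) where
  "A \<otimes>\<^sub>K B = (\<chi> r s. A $ block r $ block s * B $ entry r $ entry s)"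

definition block_diag :: "complex^2^2 \<Rightarrow> complex^2^2 \<Rightarrow> complex^4^4" where
  "block_diag A B = (\<chi> r s. if block r \<noteq> block s then 0
      else if block r = 1 then A $ entry r $ entry s else B $ entry r $ entry s)"

definition J4_tilde :: "complex^4^4" where
  "J4_tilde = block_diag J2 J2"

definition g_basis :: "(complex^4^4) list" where
  "g_basis =
    [sigma_x \<otimes>\<^sub>K cmul \<i> (mat 1),
     cmul \<i> sigma_y \<otimes>\<^sub>K sigma_y,
     cmul \<i> sigma_y \<otimes>\<^sub>K sigma_z,
     cmul \<i> sigma_z \<otimes>\<^sub>K mat 1,
     cmul \<i> sigma_y \<otimes>\<^sub>K sigma_x]"

end

(*
  The 2^5 increasing products of the generators span Cl(0,5), and M(4,C) has real dimension 32, so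
  it suffices that the g_i generate M(4,C): the induced surjection from Cl(0,5) is then injective.
  They generate since their product is i I; the generated algebra is therefore complex, and it
  contains all tensor products of Pauli matrices. An anti-automorphism is determined by its values
  on the generators. The given involution sends A (x) B to A^T (x) J_2^{-1} B^T J_2, whose second
  factor is the adjugate of B: it fixes I and negates the Pauli matrices. So it fixes each g_i, where
  either A is symmetric and B a multiple of I, or A is antisymmetric and B a Pauli matrix.
*)
theory Submission
  imports Defs
begin

section \<open>Evaluation of the free algebra\<close>

lemma matrix_add_rdistrib:
  fixes A B :: "'a::semiring_1^'m^'n"
  shows "(A + B) ** C = A ** C + B ** C"
  by (simp add: matrix_matrix_mult_def vec_eq_iff distrib_right sum.distrib)

lemma eval_word_Nil [simp]: "eval_word gs [] = mat 1"
  by (simp add: eval_word_def)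

lemma eval_word_Cons [simp]: "eval_word gs (i # w) = gs ! i ** eval_word gs w"
  by (simp add: eval_word_def)

lemma eval_word_append: "eval_word gs (u @ v) = eval_word gs u ** eval_word gs v"
  by (induction u) (simp_all add: matrix_mul_assoc)

lemma eval_free_superset:
  assumes "finite S" "Poly_Mapping.keys f \<subseteq> S"
  shows "eval_free gs f = (\<Sum>w\<in>S. Poly_Mapping.lookup f w *\<^sub>R eval_word gs w)"
  unfolding eval_free_def using assms
  by (intro sum.mono_neutral_left) (auto simp: in_keys_iff)

lemma eval_free_zero [simp]: "eval_free gs 0 = 0"
  by (simp add: eval_free_def)

lemma eval_free_single [simp]: "eval_free gs (Poly_Mapping.single w c) = c *\<^sub>R eval_word gs w"
  by (subst eval_free_superset[of "{w}"]) auto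

lemma eval_free_add: "eval_free gs (f + g) = eval_free gs f + eval_free gs g"
proof -
  let ?S = "Poly_Mapping.keys f \<union> Poly_Mapping.keys g"
  have "eval_free gs h = (\<Sum>w\<in>?S. Poly_Mapping.lookup h w *\<^sub>R eval_word gs w)"
    if "h \<in> {f, g, f + g}" for h
    using that keys_add[of f g] by (intro eval_free_superset) auto
  then show ?thesis
    by (simp add: lookup_add scaleR_add_left sum.distrib)
qed

lemma eval_free_diff: "eval_free gs (f - g) = eval_free gs f - eval_free gs g"
  by (metis eval_free_add add_diff_cancel_right' diff_add_cancel)

lemma zero_in_free_alg: "0 \<in> free_alg n"
  by (simp add: free_alg_def)

lemma single_in_free_alg: "set w \<subseteq> {..<n} \<Longrightarrow> Poly_Mapping.single w c \<in> free_alg n"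
  by (simp add: free_alg_def)

lemma add_in_free_alg: "f \<in> free_alg n \<Longrightarrow> g \<in> free_alg n \<Longrightarrow> f + g \<in> free_alg n"
  using keys_add[of f g] unfolding free_alg_def by blast

lemma diff_in_free_alg: "f \<in> free_alg n \<Longrightarrow> g \<in> free_alg n \<Longrightarrow> f - g \<in> free_alg n"
  using keys_diff[of f g] unfolding free_alg_def by blast

text \<open>Turns surjectivity of the evaluation into a spanning statement, so that linear algebra
  over the reals applies to it.\<close>

lemma eval_free_image:
  "eval_free gs ` free_alg n = span (eval_word gs ` {w. set w \<subseteq> {..<n}})" (is "?L = span ?B")
proof
  show "?L \<subseteq> span ?B"
    unfolding eval_free_def free_alg_def
    by (auto intro!: span_sum span_scale intro: span_base)
  show "span ?B \<subseteq> ?L"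
  proof
    fix X assume "X \<in> span ?B"
    then show "X \<in> ?L"
    proof (induction rule: span_induct_alt)
      case base
      show ?case
        using zero_in_free_alg by force
    next
      case (step c x y)
      then obtain w f where "set w \<subseteq> {..<n}" "x = eval_word gs w" "f \<in> free_alg n" "y = eval_free gs f"
        by auto
      then have "c *\<^sub>R x + y = eval_free gs (Poly_Mapping.single w c + f)"
        and "Poly_Mapping.single w c + f \<in> free_alg n"
        by (simp_all add: eval_free_add add_in_free_alg single_in_free_alg)
      then show ?case
        by blast
    qed
  qed
qed

text \<open>Concatenated words evaluate to products, and multiplication is bilinear. With the empty
  word giving \<open>mat 1\<close>, the span is thus the real subalgebra generated by the
  \<open>gs ! i\<close> with \<open>i\<close> in \<open>A\<close>.\<close>

lemma span_words_mult:
  assumes X: "X \<in> span (eval_word gs ` {w. set w \<subseteq> A})" (is "_ \<in> span ?B")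
    and Y: "Y \<in> span (eval_word gs ` {w. set w \<subseteq> A})"
  shows "X ** Y \<in> span (eval_word gs ` {w. set w \<subseteq> A})"
proof -
  \<comment> \<open>Linearity in the right factor comes first, with a single word on the left; the
    second induction then treats the left factor.\<close>
  have *: "eval_word gs u ** Y \<in> span ?B" if u: "set u \<subseteq> A" for u
    using Y
  proof (induction rule: span_induct_alt)
    case (step c x y)
    then obtain v where "set v \<subseteq> A" "x = eval_word gs v"
      by auto
    then have "eval_word gs u ** x \<in> ?B"
      using u by (auto simp: eval_word_append[symmetric] intro!: imageI)
    then have "c *\<^sub>R (eval_word gs u ** x) + eval_word gs u ** y \<in> span ?B"
      using step by (intro span_add span_scale) (auto intro: span_base)
    then show ?case
      by (simp add: matrix_add_ldistrib matrix_scalar_ac scalar_matrix_assoc)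
  qed (simp add: span_zero)
  show ?thesis
    using X
  proof (induction rule: span_induct_alt)
    case (step c x y)
    then have "c *\<^sub>R (x ** Y) + y ** Y \<in> span ?B"
      using * by (auto intro!: span_add span_scale)
    then show ?case
      by (simp add: matrix_add_rdistrib scalar_matrix_assoc)
  qed (simp add: span_zero)
qed

section \<open>Normal forms modulo the Clifford ideal\<close>

lemma clifford_ideal_subset_free_alg: "f \<in> clifford_ideal p q \<Longrightarrow> f \<in> free_alg (p + q)"
proof (induction rule: clifford_ideal.induct)
  case (anticommute i j u v c)
  then show ?case
    by (intro add_in_free_alg single_in_free_alg) auto
next
  case (square i u v c)
  then show ?case
    by (intro diff_in_free_alg single_in_free_alg) auto
qed (simp_all add: zero_in_free_alg add_in_free_alg)

text \<open>In each generator of the ideal the contexts factor out, leaving a relation that the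
  matrices satisfy. Hence evaluation descends to the quotient \<open>Cl(p,q)\<close>.\<close>

lemma eval_free_clifford_ideal:
  assumes "clifford_relations p q gs"
  shows "f \<in> clifford_ideal p q \<Longrightarrow> eval_free gs f = 0"
proof (induction rule: clifford_ideal.induct)
  case (anticommute i j u v c)
  then have "gs ! i ** gs ! j = - (gs ! j ** gs ! i)"
    using assms unfolding clifford_relations_def by blast
  then have ij: "gs ! i ** gs ! j + gs ! j ** gs ! i = 0"
    by (simp only: eq_neg_iff_add_eq_0)
  have "eval_word gs (u @ [i, j] @ v) + eval_word gs (u @ [j, i] @ v)
      = eval_word gs u ** (gs ! i ** gs ! j + gs ! j ** gs ! i) ** eval_word gs v"
    by (simp add: eval_word_append matrix_mul_assoc matrix_add_ldistrib matrix_add_rdistrib)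
  then show ?case
    by (simp add: eval_free_add ij flip: scaleR_add_right)
next
  case (square i u v c)
  then have sq: "gs ! i ** gs ! i = clifford_sign p i *\<^sub>R mat 1"
    using assms by (simp add: clifford_relations_def)
  have "eval_word gs (u @ [i, i] @ v) = eval_word gs u ** (gs ! i ** gs ! i) ** eval_word gs v"
    by (simp add: eval_word_append matrix_mul_assoc)
  also have "\<dots> = clifford_sign p i *\<^sub>R eval_word gs (u @ v)"
    by (simp add: sq eval_word_append matrix_scalar_ac flip: scalar_matrix_assoc)
  finally have "eval_word gs (u @ [i, i] @ v) = clifford_sign p i *\<^sub>R eval_word gs (u @ v)" .
  then show ?case
    by (simp add: eval_free_diff)
qed (simp_all add: eval_free_add)

text \<open>The contexts \<open>u\<close> and \<open>t\<close> make this a congruence for concatenation by construction.\<close>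

definition word_equiv :: "nat \<Rightarrow> nat \<Rightarrow> nat list \<Rightarrow> real \<Rightarrow> nat list \<Rightarrow> bool" where
  "word_equiv p q w s v \<longleftrightarrow> (\<forall>u t c. set u \<subseteq> {..<p + q} \<longrightarrow> set t \<subseteq> {..<p + q} \<longrightarrow>
     Poly_Mapping.single (u @ w @ t) c - Poly_Mapping.single (u @ v @ t) (c * s)
       \<in> clifford_ideal p q)"

lemma word_equiv_refl: "word_equiv p q w 1 w"
  by (simp add: word_equiv_def clifford_ideal.zero)

lemma word_equiv_trans:
  assumes "word_equiv p q w s v" "word_equiv p q v s' z"
  shows "word_equiv p q w (s * s') z"
  unfolding word_equiv_def
proof (intro allI impI)
  fix u t :: "nat list" and c :: real
  assume ut: "set u \<subseteq> {..<p + q}" "set t \<subseteq> {..<p + q}"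
  \<comment> \<open>The sum telescopes: the monomial through \<open>v\<close> cancels.\<close>
  have "(Poly_Mapping.single (u @ w @ t) c - Poly_Mapping.single (u @ v @ t) (c * s))
      + (Poly_Mapping.single (u @ v @ t) (c * s) - Poly_Mapping.single (u @ z @ t) (c * s * s'))
      \<in> clifford_ideal p q"
    using assms ut unfolding word_equiv_def by (intro clifford_ideal.add) blast+
  then show "Poly_Mapping.single (u @ w @ t) c - Poly_Mapping.single (u @ z @ t) (c * (s * s'))
      \<in> clifford_ideal p q"
    by (simp add: mult.assoc)
qed

lemma word_equiv_append:
  assumes "word_equiv p q w s v" "set a \<subseteq> {..<p + q}" "set b \<subseteq> {..<p + q}"
  shows "word_equiv p q (a @ w @ b) s (a @ v @ b)"
  unfolding word_equiv_def
proof (intro allI impI)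
  fix u t :: "nat list" and c :: real
  assume "set u \<subseteq> {..<p + q}" "set t \<subseteq> {..<p + q}"
  then have "set (u @ a) \<subseteq> {..<p + q}" "set (b @ t) \<subseteq> {..<p + q}"
    using assms by auto
  then have "Poly_Mapping.single ((u @ a) @ w @ b @ t) c
      - Poly_Mapping.single ((u @ a) @ v @ b @ t) (c * s) \<in> clifford_ideal p q"
    using assms(1) unfolding word_equiv_def by blast
  then show "Poly_Mapping.single (u @ (a @ w @ b) @ t) c
      - Poly_Mapping.single (u @ (a @ v @ b) @ t) (c * s) \<in> clifford_ideal p q"
    by simp
qed

lemma word_equiv_square: "i < p + q \<Longrightarrow> word_equiv p q [i, i] (clifford_sign p i) []"
  unfolding word_equiv_def using clifford_ideal.square[of i p q] by simp

lemma word_equiv_swap: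
  "i < p + q \<Longrightarrow> j < p + q \<Longrightarrow> i \<noteq> j \<Longrightarrow> word_equiv p q [i, j] (- 1) [j, i]"
  unfolding word_equiv_def using clifford_ideal.anticommute[of i p q j]
  by (simp add: single_uminus)

text \<open>One step of insertion sort: \<open>x\<close> stays in front of a larger letter, cancels
  against an equal one by the square relation, or passes a smaller one at the cost of a
  sign.\<close>

lemma word_equiv_insert:
  assumes "x < p + q" "sorted_wrt (<) v" "set v \<subseteq> {..<p + q}"
  shows "\<exists>s z. word_equiv p q (x # v) s z \<and> sorted_wrt (<) z \<and> set z \<subseteq> insert x (set v)"
  using assms(2,3)
proof (induction v)
  case Nil
  show ?case
    using word_equiv_refl[of p q "[x]"] by (intro exI[of _ 1] exI[of _ "[x]"]) simp
next
  case (Cons y v)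
  consider "x < y" | "x = y" | "y < x"
    by linarith
  then show ?case
  proof cases
    case 1
    then show ?thesis
      using word_equiv_refl[of p q "x # y # v"] Cons.prems
      by (intro exI[of _ 1] exI[of _ "x # y # v"]) auto
  next
    case 2
    then show ?thesis
      using word_equiv_append[OF word_equiv_square, of x p q "[]" v] Cons.prems assms(1)
      by (intro exI[of _ "clifford_sign p x"] exI[of _ v]) auto
  next
    case 3
    obtain s z where z: "word_equiv p q (x # v) s z" "sorted_wrt (<) z" "set z \<subseteq> insert x (set v)"
      using Cons by auto
    have "word_equiv p q (x # y # v) (- 1) (y # x # v)"
      using word_equiv_append[OF word_equiv_swap, of x p q y "[]" v] Cons.prems assms(1) 3 by auto
    moreover have "word_equiv p q (y # x # v) s (y # z)"
      using word_equiv_append[OF z(1), of "[y]" "[]"] Cons.prems by auto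
    ultimately have "word_equiv p q (x # y # v) (- 1 * s) (y # z)"
      by (rule word_equiv_trans)
    \<comment> \<open>The bound on \<open>set z\<close> is what keeps \<open>y\<close> below every
      letter of \<open>z\<close>.\<close>
    moreover have "sorted_wrt (<) (y # z)" "set (y # z) \<subseteq> insert x (set (y # v))"
      using z Cons.prems 3 by auto
    ultimately show ?thesis
      by blast
  qed
qed

lemma word_equiv_sorted:
  assumes "set w \<subseteq> {..<p + q}"
  shows "\<exists>s v. word_equiv p q w s v \<and> sorted_wrt (<) v \<and> set v \<subseteq> {..<p + q}"
  using assms
proof (induction w)
  case Nil
  show ?case
    using word_equiv_refl[of p q "[]"] by (intro exI[of _ 1] exI[of _ "[]"]) simp
next
  case (Cons x w)
  then obtain s v where v: "word_equiv p q w s v" "sorted_wrt (<) v" "set v \<subseteq> {..<p + q}"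
    by auto
  moreover have "x < p + q"
    using Cons.prems by simp
  ultimately obtain s' z where z: "word_equiv p q (x # v) s' z" "sorted_wrt (<) z"
      "set z \<subseteq> insert x (set v)"
    using word_equiv_insert by meson
  have "word_equiv p q (x # w) s (x # v)"
    using word_equiv_append[OF v(1), of "[x]" "[]"] Cons.prems by simp
  then have "word_equiv p q (x # w) (s * s') z"
    using z(1) by (rule word_equiv_trans)
  then show ?case
    using z v \<open>x < p + q\<close> by blast
qed

text \<open>The increasing words stand for the usual basis monomials of the Clifford algebra, one
  for each subset of the generators.\<close>

definition sorted_words :: "nat \<Rightarrow> nat list set" where
  "sorted_words n = {v. sorted_wrt (<) v \<and> set v \<subseteq> {..<n}}"

lemma sorted_words_eq: "sorted_words n = sorted_list_of_set ` Pow {..<n}"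
proof
  show "sorted_words n \<subseteq> sorted_list_of_set ` Pow {..<n}"
  proof
    fix v assume "v \<in> sorted_words n"
    then have "v = sorted_list_of_set (set v)" "set v \<in> Pow {..<n}"
      by (auto simp: sorted_words_def strict_sorted_equal)
    then show "v \<in> sorted_list_of_set ` Pow {..<n}"
      by blast
  qed
  have "sorted_list_of_set A \<in> sorted_words n" if "A \<subseteq> {..<n}" for A
    using that finite_subset[OF that] by (simp add: sorted_words_def)
  then show "sorted_list_of_set ` Pow {..<n} \<subseteq> sorted_words n"
    by blast
qed

lemma finite_sorted_words: "finite (sorted_words n)"
  by (simp add: sorted_words_eq)

lemma card_sorted_words: "card (sorted_words n) \<le> 2 ^ n"
  using card_image_le[of "Pow {..<n}" sorted_list_of_set]
  by (simp add: sorted_words_eq card_Pow)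

lemma clifford_ideal_sum:
  "finite A \<Longrightarrow> (\<And>x. x \<in> A \<Longrightarrow> h x \<in> clifford_ideal p q) \<Longrightarrow> sum h A \<in> clifford_ideal p q"
  by (induction rule: finite_induct) (simp_all add: clifford_ideal.zero clifford_ideal.add)

lemma poly_mapping_eq_sum_single:
  "f = (\<Sum>w\<in>Poly_Mapping.keys f. Poly_Mapping.single w (Poly_Mapping.lookup f w))"
  by (rule poly_mapping_eqI)
    (auto simp: lookup_sum lookup_single when_def in_keys_iff sum.delta')

text \<open>Each word of \<open>f\<close> is sorted separately and carries its coefficient along;
  the errors lie in the ideal, hence so does their sum.\<close>

lemma clifford_normal_form:
  assumes "f \<in> free_alg (p + q)"
  shows "\<exists>g. f - g \<in> clifford_ideal p q \<and> Poly_Mapping.keys g \<subseteq> sorted_words (p + q)"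
proof -
  have "\<forall>w\<in>Poly_Mapping.keys f. \<exists>s v. word_equiv p q w s v \<and> v \<in> sorted_words (p + q)"
    using assms word_equiv_sorted by (auto simp: free_alg_def sorted_words_def)
  then obtain s v where sv: "\<And>w. w \<in> Poly_Mapping.keys f \<Longrightarrow> word_equiv p q w (s w) (v w)"
      "\<And>w. w \<in> Poly_Mapping.keys f \<Longrightarrow> v w \<in> sorted_words (p + q)"
    by metis
  define g where
    "g = (\<Sum>w\<in>Poly_Mapping.keys f. Poly_Mapping.single (v w) (Poly_Mapping.lookup f w * s w))"
  have "f - g = (\<Sum>w\<in>Poly_Mapping.keys f. Poly_Mapping.single w (Poly_Mapping.lookup f w)
      - Poly_Mapping.single (v w) (Poly_Mapping.lookup f w * s w))"
    unfolding g_def by (subst poly_mapping_eq_sum_single[of f]) (simp add: sum_subtractf)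
  also have "\<dots> \<in> clifford_ideal p q"
  proof (rule clifford_ideal_sum)
    fix w assume "w \<in> Poly_Mapping.keys f"
    then show "Poly_Mapping.single w (Poly_Mapping.lookup f w)
        - Poly_Mapping.single (v w) (Poly_Mapping.lookup f w * s w) \<in> clifford_ideal p q"
      using sv(1)[unfolded word_equiv_def, rule_format, of w "[]" "[]"] by simp
  qed simp
  finally have "f - g \<in> clifford_ideal p q" .
  moreover have "Poly_Mapping.keys g \<subseteq> sorted_words (p + q)"
    unfolding g_def using keys_sum sv(2) by (fastforce split: if_splits)
  ultimately show ?thesis
    by blast
qed

section \<open>Injectivity by a dimension count\<close>

text \<open>The values of the sorted words span the whole matrix algebra, and there are at most as
  many of them as its real dimension. So they are independent, and a normal form that evaluates to 0
  is itself 0.\<close>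

lemma one_vector_basisI:
  fixes gs :: "(complex^'n^'n) list"
  assumes rel: "clifford_relations p q gs"
    and surj: "eval_free gs ` free_alg (p + q) = UNIV"
    and dim: "2 ^ (p + q) \<le> DIM(complex^'n^'n)"
  shows "one_vector_basis p q gs"
proof -
  let ?W = "sorted_words (p + q)" and ?e = "eval_word gs"
  note fin = finite_sorted_words[of "p + q"]
  have nf: "\<exists>g. f - g \<in> clifford_ideal p q \<and> Poly_Mapping.keys g \<subseteq> ?W
      \<and> eval_free gs f = (\<Sum>w\<in>?W. Poly_Mapping.lookup g w *\<^sub>R ?e w)"
    if "f \<in> free_alg (p + q)" for f
  proof -
    obtain g where g: "f - g \<in> clifford_ideal p q" "Poly_Mapping.keys g \<subseteq> ?W"
      using clifford_normal_form \<open>f \<in> free_alg (p + q)\<close> by blast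
    then have "eval_free gs f = eval_free gs g"
      using eval_free_clifford_ideal[OF rel g(1)] by (simp add: eval_free_diff)
    then show ?thesis
      using g eval_free_superset[OF fin g(2)] by auto
  qed
  have "X \<in> span (?e ` ?W)" for X
  proof -
    obtain f where "f \<in> free_alg (p + q)" "X = eval_free gs f"
      using surj by blast
    then show ?thesis
      using nf[of f] by (auto intro!: span_sum span_scale span_base[OF imageI])
  qed
  then have span: "UNIV \<subseteq> span (?e ` ?W)"
    by blast
  have "DIM(complex^'n^'n) \<le> card (?e ` ?W)"
    using dim_le_card[OF span] fin by (simp add: dim_UNIV)
  moreover have "card (?e ` ?W) \<le> card ?W"
    using fin by (rule card_image_le)
  ultimately have card: "card (?e ` ?W) = card ?W" "card (?e ` ?W) = DIM(complex^'n^'n)"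
    using card_sorted_words[of "p + q"] dim by linarith+
  have inj: "inj_on ?e ?W"
    using fin card(1) by (rule eq_card_imp_inj_on)
  have ind: "independent (?e ` ?W)"
    using span fin card(2) by (intro card_le_dim_spanning[of _ UNIV]) (auto simp: dim_UNIV)
  \<comment> \<open>Independence of the set of values becomes independence of the family indexed by
    words, since \<open>?e\<close> is injective on \<open>?W\<close>.\<close>
  have zero: "a w = 0" if "(\<Sum>w\<in>?W. a w *\<^sub>R ?e w) = 0" "w \<in> ?W" for a w
  proof -
    have "(\<Sum>x\<in>?e ` ?W. a (the_inv_into ?W ?e x) *\<^sub>R x) = 0"
      using that(1) inj by (simp add: sum.reindex the_inv_into_f_f)
    then have "a (the_inv_into ?W ?e (?e w)) = 0"
      using independentD[OF ind finite_imageI[OF fin] subset_refl,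
          of "\<lambda>x. a (the_inv_into ?W ?e x)"] that(2) by blast
    then show ?thesis
      using inj that(2) by (simp add: the_inv_into_f_f)
  qed
  have "f \<in> clifford_ideal p q" if f: "f \<in> free_alg (p + q)" "eval_free gs f = 0" for f
  proof -
    obtain g where g: "f - g \<in> clifford_ideal p q" "Poly_Mapping.keys g \<subseteq> ?W"
        "(\<Sum>w\<in>?W. Poly_Mapping.lookup g w *\<^sub>R ?e w) = 0"
      using nf[OF f(1)] f(2) by auto
    have "Poly_Mapping.lookup g w = 0" for w
      using zero[OF g(3), of w] g(2) by (auto simp: in_keys_iff)
    then have "g = 0"
      by (intro poly_mapping_eqI) simp
    then show ?thesis
      using g(1) by simp
  qed
  then show ?thesis
    unfolding one_vector_basis_def
    using rel surj clifford_ideal_subset_free_alg eval_free_clifford_ideal[OF rel] by blast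
qed

text \<open>An anti-automorphism reverses words in the fixed generators, so both maps agree on all
  words, and by surjectivity the words span.\<close>

lemma is_reversion_unique:
  assumes surj: "eval_free gs ` free_alg (length gs) = UNIV"
    and "is_reversion gs \<Phi>" "is_reversion gs \<Psi>"
  shows "\<Phi> = \<Psi>"
proof
  fix X
  have lin: "linear \<Phi>" "linear \<Psi>"
    using assms by (simp_all add: is_reversion_def)
  have w: "\<Phi> (eval_word gs w) = \<Psi> (eval_word gs w)" if "set w \<subseteq> {..<length gs}" for w
    using that
  proof (induction w)
    case Nil
    then show ?case
      using assms(2,3) by (simp add: is_reversion_def)
  next
    case (Cons i w)
    then have "gs ! i \<in> span (set gs)"
      by (auto intro: span_base)
    then show ?case
      using Cons assms(2,3) by (simp add: is_reversion_def)
  qed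
  have "X \<in> span (eval_word gs ` {w. set w \<subseteq> {..<length gs}})"
    using surj by (simp add: eval_free_image)
  then show "\<Phi> X = \<Psi> X"
    by (rule linear_eq_on[OF lin]) (use w in auto)
qed

section \<open>The generators\<close>

lemmas matrix_entries = vec_eq_iff forall_2 forall_4 sum_2 sum_4 matrix_matrix_mult_def mat_def
  sigma_x_def sigma_y_def sigma_z_def J2_def cmul_def kron_def block_def entry_def
  block_diag_def J4_tilde_def transpose_def

lemma kron_mult: "(A \<otimes>\<^sub>K B) ** (C \<otimes>\<^sub>K D) = (A ** C) \<otimes>\<^sub>K (B ** D)"
  by (simp add: matrix_entries algebra_simps)

lemma transpose_kron: "transpose (A \<otimes>\<^sub>K B) = transpose A \<otimes>\<^sub>K transpose B"
  by (simp add: kron_def transpose_def vec_eq_iff)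

text \<open>Together with \<open>kron_mult\<close>, these rules collapse long products factor by
  factor in size 2, before any entries of size 4 are expanded.\<close>

lemma mat2_simps:
  "(mat 1 :: complex^2^2) = vector [vector [1, 0], vector [0, 1]]"
  "cmul k (vector [vector [a, b], vector [c, d]] :: complex^2^2)
    = vector [vector [k * a, k * b], vector [k * c, k * d]]"
  "transpose (vector [vector [a, b], vector [c, d]] :: complex^2^2)
    = vector [vector [a, c], vector [b, d]]"
  "(vector [vector [a, b], vector [c, d]] :: complex^2^2)
      ** (vector [vector [a', b'], vector [c', d']] :: complex^2^2)
    = vector [vector [a * a' + b * c', a * b' + b * d'], vector [c * a' + d * c', c * b' + d * d']]"
  by (simp_all add: matrix_entries)

lemmas pauli_simps = sigma_x_def sigma_y_def sigma_z_def J2_def mat2_simps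

lemma cmul_mult: "cmul c A ** B = cmul c (A ** B)"
  by (simp add: cmul_def matrix_matrix_mult_def vec_eq_iff sum_distrib_left mult.assoc)

text \<open>Shows that a real subalgebra containing \<open>cmul \<i> (mat 1)\<close> is closed under
  complex scalars.\<close>

lemma cmul_eq: "cmul c X = Re c *\<^sub>R X + Im c *\<^sub>R (cmul \<i> (mat 1) ** X)"
  unfolding cmul_mult matrix_mul_lid
  by (simp add: cmul_def vec_eq_iff complex_eq_iff)

lemma g_basis_relations: "clifford_relations 0 5 g_basis"
proof -
  \<comment> \<open>Unrolling the bounded quantifiers leaves finitely many explicit matrix
    identities.\<close>
  have five: "(\<forall>i<5. P i) \<longleftrightarrow> P 0 \<and> P 1 \<and> P 2 \<and> P 3 \<and> P (4::nat)" for P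
    by (simp add: eval_nat_numeral less_Suc_eq all_conj_distrib)
  show ?thesis
    unfolding clifford_relations_def add_0 five g_basis_def
    by (simp add: clifford_sign_def kron_mult) (simp add: matrix_entries)
qed

lemma g_basis_surj: "eval_free g_basis ` free_alg 5 = UNIV"
proof -
  \<comment> \<open>\<open>S\<close> is the real subalgebra generated by the five matrices; the goal
    is that it is everything.\<close>
  define S where "S = span (eval_word g_basis ` {w. set w \<subseteq> {..<5}})"
  have mult: "X ** Y \<in> S" if "X \<in> S" "Y \<in> S" for X Y
    using that unfolding S_def by (rule span_words_mult)
  have add: "X + Y \<in> S" if "X \<in> S" "Y \<in> S" for X Y
    using that unfolding S_def by (rule span_add)
  have scale: "c *\<^sub>R X \<in> S" if "X \<in> S" for c X
    using that unfolding S_def by (rule span_scale)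
  have word: "eval_word g_basis w \<in> S" if "set w \<subseteq> {..<5}" for w
    using that unfolding S_def by (intro span_base) auto
  have g: "sigma_x \<otimes>\<^sub>K cmul \<i> (mat 1) \<in> S" "cmul \<i> sigma_y \<otimes>\<^sub>K sigma_y \<in> S"
      "cmul \<i> sigma_y \<otimes>\<^sub>K sigma_z \<in> S" "cmul \<i> sigma_z \<otimes>\<^sub>K mat 1 \<in> S"
      "cmul \<i> sigma_y \<otimes>\<^sub>K sigma_x \<in> S"
    using word[of "[0]"] word[of "[1]"] word[of "[2]"] word[of "[3]"] word[of "[4]"]
    by (simp_all add: g_basis_def)
  have "eval_word g_basis [0, 1, 2, 3, 4] = cmul \<i> (mat 1)"
    by (simp add: g_basis_def kron_mult pauli_simps) (simp add: matrix_entries)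
  then have I: "cmul \<i> (mat 1) \<in> S"
    using word[of "[0, 1, 2, 3, 4]"] by simp
  have cmul: "cmul c X \<in> S" if "X \<in> S" for c X
    by (subst cmul_eq) (intro add scale mult that I)
  have one: "mat 1 \<in> S"
    using word[of "[]"] by simp
  \<comment> \<open>Complex scalars are now available, so the factor \<open>\<i>\<close> can be
    stripped from the first and fourth generators.\<close>
  have "cmul (- \<i>) (sigma_x \<otimes>\<^sub>K cmul \<i> (mat 1)) = sigma_x \<otimes>\<^sub>K mat 1"
      "cmul (- \<i>) (cmul \<i> sigma_z \<otimes>\<^sub>K mat 1) = sigma_z \<otimes>\<^sub>K mat 1"
    by (simp_all add: matrix_entries)
  then have x1: "sigma_x \<otimes>\<^sub>K mat 1 \<in> S" and z1: "sigma_z \<otimes>\<^sub>K mat 1 \<in> S"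
    using cmul g(1,4) by metis+
  have "sigma_z ** sigma_x = cmul \<i> sigma_y"
    by (simp add: pauli_simps)
  then have y1: "cmul \<i> sigma_y \<otimes>\<^sub>K mat 1 \<in> S"
    using mult[OF z1 x1] by (simp add: kron_mult)
  have left: "A \<otimes>\<^sub>K mat 1 \<in> S" for A
  proof -
    \<comment> \<open>The expansion of \<open>A\<close> in the complex basis \<open>mat 1\<close>,
      \<open>sigma_z\<close>, \<open>sigma_x\<close>, \<open>cmul \<i> sigma_y\<close> of the 2 by 2
      matrices.\<close>
    have "A \<otimes>\<^sub>K mat 1 = cmul ((A $ 1 $ 1 + A $ 2 $ 2) / 2) (mat 1)
        + cmul ((A $ 1 $ 1 - A $ 2 $ 2) / 2) (sigma_z \<otimes>\<^sub>K mat 1)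
        + cmul ((A $ 1 $ 2 + A $ 2 $ 1) / 2) (sigma_x \<otimes>\<^sub>K mat 1)
        + cmul ((A $ 1 $ 2 - A $ 2 $ 1) / 2) (cmul \<i> sigma_y \<otimes>\<^sub>K mat 1)"
      by (simp add: matrix_entries field_simps)
    then show ?thesis
      using one x1 y1 z1 by (simp add: add cmul)
  qed
  \<comment> \<open>Multiplying by the inverse of the left factor isolates the Pauli matrix on the
    right of the second, third and fifth generators.\<close>
  have y1_cancel: "mat 1 \<otimes>\<^sub>K B \<in> S" if "cmul \<i> sigma_y \<otimes>\<^sub>K B \<in> S" for B
  proof -
    have "cmul (- \<i>) sigma_y ** cmul \<i> sigma_y = mat 1"
      by (simp add: pauli_simps)
    then have "(cmul (- \<i>) sigma_y \<otimes>\<^sub>K mat 1) ** (cmul \<i> sigma_y \<otimes>\<^sub>K B) = mat 1 \<otimes>\<^sub>K B"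
      by (simp add: kron_mult)
    then show ?thesis
      using mult[OF left that] by metis
  qed
  have right: "mat 1 \<otimes>\<^sub>K B \<in> S" for B
  proof -
    \<comment> \<open>The same expansion for \<open>B\<close>, now with \<open>sigma_y\<close>
      itself, whence the extra \<open>\<i>\<close> in the last coefficient.\<close>
    have "mat 1 \<otimes>\<^sub>K B = cmul ((B $ 1 $ 1 + B $ 2 $ 2) / 2) (mat 1)
        + cmul ((B $ 1 $ 1 - B $ 2 $ 2) / 2) (mat 1 \<otimes>\<^sub>K sigma_z)
        + cmul ((B $ 1 $ 2 + B $ 2 $ 1) / 2) (mat 1 \<otimes>\<^sub>K sigma_x)
        + cmul (\<i> * (B $ 1 $ 2 - B $ 2 $ 1) / 2) (mat 1 \<otimes>\<^sub>K sigma_y)"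
      by (simp add: matrix_entries field_simps)
    then show ?thesis
      using one g y1_cancel by (simp add: add cmul)
  qed
  have kron: "A \<otimes>\<^sub>K B \<in> S" for A B
    using mult[OF left right, of A B] by (simp add: kron_mult)
  have "X \<in> S" for X
  proof -
    \<comment> \<open>\<open>X\<close> is cut into four blocks, each placed by a matrix unit in the
      left factor.\<close>
    have "X = vector [vector [1, 0], vector [0, 0]]
          \<otimes>\<^sub>K vector [vector [X $ 1 $ 1, X $ 1 $ 2], vector [X $ 2 $ 1, X $ 2 $ 2]]
        + vector [vector [0, 1], vector [0, 0]]
          \<otimes>\<^sub>K vector [vector [X $ 1 $ 3, X $ 1 $ 4], vector [X $ 2 $ 3, X $ 2 $ 4]]
        + vector [vector [0, 0], vector [1, 0]]
          \<otimes>\<^sub>K vector [vector [X $ 3 $ 1, X $ 3 $ 2], vector [X $ 4 $ 1, X $ 4 $ 2]]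
        + vector [vector [0, 0], vector [0, 1]]
          \<otimes>\<^sub>K vector [vector [X $ 3 $ 3, X $ 3 $ 4], vector [X $ 4 $ 3, X $ 4 $ 4]]"
      by (simp add: matrix_entries)
    also have "\<dots> \<in> S"
      by (intro add kron)
    finally show ?thesis .
  qed
  then show ?thesis
    by (auto simp: eval_free_image S_def)
qed

section \<open>The involution defined by \<open>J4_tilde\<close>\<close>

text \<open>\<open>matrix_inv\<close> is a choice among two-sided inverses; associativity leaves
  only one candidate.\<close>

lemma matrix_inv_eqI:
  fixes A B :: "'a::semiring_1^'n^'n"
  assumes "A ** B = mat 1" "B ** A = mat 1"
  shows "matrix_inv A = B"
proof -
  have "\<exists>C. A ** C = mat 1 \<and> C ** A = mat 1"
    using assms by blast
  then have "matrix_inv A ** A = mat 1"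
    unfolding matrix_inv_def by (metis (mono_tags, lifting) someI_ex)
  then show ?thesis
    by (metis assms(1) matrix_mul_assoc matrix_mul_lid matrix_mul_rid)
qed

text \<open>In this form, conjugation by \<open>J4_tilde\<close> acts on the second Kronecker factor
  alone.\<close>

lemma J4_tilde_kron: "J4_tilde = mat 1 \<otimes>\<^sub>K J2"
  by (simp add: matrix_entries)

lemma matrix_inv_J4_tilde: "matrix_inv J4_tilde = transpose J4_tilde"
  by (rule matrix_inv_eqI; simp add: J4_tilde_kron transpose_kron kron_mult pauli_simps)
    (simp_all add: matrix_entries)

lemma J4_tilde_square: "J4_tilde ** J4_tilde = (- 1) *\<^sub>R mat 1"
  by (simp add: J4_tilde_kron kron_mult pauli_simps) (simp add: matrix_entries)

lemma is_reversion_g_basis: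
  "is_reversion g_basis (\<lambda>X. matrix_inv J4_tilde ** transpose X ** J4_tilde)"
  (is "is_reversion _ ?\<Phi>")
proof -
  have inv: "J4_tilde ** matrix_inv J4_tilde = mat 1" "matrix_inv J4_tilde ** J4_tilde = mat 1"
    unfolding matrix_inv_J4_tilde
    by (simp_all add: J4_tilde_kron transpose_kron kron_mult pauli_simps)
      (simp_all add: matrix_entries)
  have lin: "linear ?\<Phi>"
  proof (rule linearI)
    show "?\<Phi> (X + Y) = ?\<Phi> X + ?\<Phi> Y" for X Y
    proof -
      have "transpose (X + Y) = transpose X + transpose Y"
        by (simp add: transpose_def vec_eq_iff)
      then show ?thesis
        by (simp add: matrix_add_ldistrib matrix_add_rdistrib)
    qed
    show "?\<Phi> (c *\<^sub>R X) = c *\<^sub>R ?\<Phi> X" for c X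
      by (simp add: transpose_scalar matrix_scalar_ac scalar_matrix_assoc)
  qed
  have anti: "?\<Phi> (X ** Y) = ?\<Phi> Y ** ?\<Phi> X" for X Y
  proof -
    \<comment> \<open>The inner \<open>J4_tilde\<close> and its inverse meet and cancel;
      transposition has already reversed the order.\<close>
    have "?\<Phi> Y ** ?\<Phi> X = matrix_inv J4_tilde ** transpose Y
        ** (J4_tilde ** matrix_inv J4_tilde) ** transpose X ** J4_tilde"
      by (simp only: matrix_mul_assoc)
    then show ?thesis
      by (simp add: inv matrix_transpose_mul matrix_mul_assoc)
  qed
  have invol: "?\<Phi> (?\<Phi> X) = X" for X
  proof -
    \<comment> \<open>The inverse is the transpose, so the outer factors pair up to squares, whose
      two signs cancel.\<close>
    have "?\<Phi> (?\<Phi> X) = transpose (J4_tilde ** J4_tilde) ** X ** (J4_tilde ** J4_tilde)"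
      by (simp add: matrix_inv_J4_tilde matrix_transpose_mul matrix_mul_assoc)
    also have "\<dots> = X"
      unfolding J4_tilde_square
      by (simp only: transpose_scalar transpose_mat matrix_scalar_ac scalar_matrix_assoc[symmetric]
          matrix_mul_lid matrix_mul_rid) simp
    finally show ?thesis .
  qed
  have gen: "?\<Phi> v = v" if "v \<in> set g_basis" for v
    using that unfolding matrix_inv_J4_tilde g_basis_def
    by (auto simp: J4_tilde_kron transpose_kron kron_mult pauli_simps) (simp_all add: matrix_entries)
  \<comment> \<open>Two linear maps that agree on the generators agree on their span.\<close>
  have "?\<Phi> v = id v" if "v \<in> span (set g_basis)" for v
    by (rule linear_eq_on[OF lin linear_id that]) (simp add: gen)
  moreover have "bij ?\<Phi>"
    by (rule o_bij[of ?\<Phi>]) (simp_all add: fun_eq_iff invol)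
  ultimately show ?thesis
    unfolding is_reversion_def using lin anti by (simp add: inv)
qed

text \<open>Unique existence is stated as well, since it is what gives the definite description in
  \<open>reversion\<close> its meaning.\<close>

theorem proposition7p1:
  shows "one_vector_basis 0 5 g_basis
    \<and> (\<exists>!\<Phi>. is_reversion g_basis \<Phi>)
    \<and> reversion g_basis = (\<lambda>X. matrix_inv J4_tilde ** transpose X ** J4_tilde)"
proof -
  have "one_vector_basis 0 5 g_basis"
    \<comment> \<open>The dimension condition is \<open>2 ^ 5\<close> \<le> 32, the real dimension
      of the complex 4 by 4 matrices.\<close>
    using g_basis_relations g_basis_surj by (intro one_vector_basisI) simp_all
  moreover have ex1: "\<exists>!\<Phi>. is_reversion g_basis \<Phi>"
  proof (rule ex_ex1I)
    have "length g_basis = 5"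
      by (simp add: g_basis_def)
    then have "eval_free g_basis ` free_alg (length g_basis) = UNIV"
      using g_basis_surj by simp
    then show "\<Phi> = \<Psi>" if "is_reversion g_basis \<Phi>" "is_reversion g_basis \<Psi>" for \<Phi> \<Psi>
      using that is_reversion_unique by blast
  qed (use is_reversion_g_basis in blast)
  moreover have "reversion g_basis = (\<lambda>X. matrix_inv J4_tilde ** transpose X ** J4_tilde)"
    using ex1 is_reversion_g_basis theI'[OF ex1, folded reversion_def] by blast
  ultimately show ?thesis
    by blast
qed

end
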